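(* Let $\gamma,\epsilon>0$ and let $\Pi(\gamma,\epsilon)$ be the posterior drift class, i.e. the set of joint distributions $P_{XYMD}$ such that (i) $\gamma(x,m)\ge\gamma$ for all $x\in\mathcal{X}$, $m\in\mathcal{M}$, and (ii) $P_{XMM'}\big(f^*_{\mathrm{DI}}(X,M)\ne f^*_{\mathrm{DI}}(X,M')\big)\ge\epsilon$, where, given $X$, $(M,M')\mid X\sim P_{M|X}\otimes P_{M|X}$ are two independent draws. Then $$ \inf_{P_{XYMD}\in\Pi(\gamma,\epsilon)}\left[R^*_{\mathrm{pool}}-R^*_{\mathrm{DI}}\right]\;\ge\;\frac{\gamma\cdot\epsilon}{2}. $$
   Context: Setting: $(X,Y,M,D)$ are jointly distributed random variables with law $P_{XYMD}$ and values in measurable spaces $\mathcal{X},\mathcal{Y},\mathcal{M},\mathcal{D}$, where $\mathcal{Y}=\{1,\dots,K\}$, $K\ge2$. $X$ is a feature vector, $Y$ a class label, $D$ a random domain (which determines the distribution $P_{XY|D}$ of $(X,Y)$), and $M$ is metadata about the domain. Standing assumption: $(X,Y)$ and $M$ are conditionally independent given $D$, i.e. $P_{XY|D,M}=P_{XY|D}$. Subscripts indicate marginal or conditional distributions (e.g. $P_{M|X}$ is the conditional distribution of $M$ given $X$); the spaces are assumed to be such that regular conditional distributions exist, and versions of them are fixed. $\mathbf{1}\{\cdot\}$ is the indicator of an event. Bayes classifiers: $f^*_{\mathrm{pool}}(x)=\arg\max_k \mathbb{P}(Y=k\mid X=x)$ and $f^*_{\mathrm{DI}}(x,m)=\arg\max_k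 \mathbb{P}(Y=k\mid X=x,M=m)$ (any measurable choice of maximizer in case of ties). Bayes risks: $R^*_{\mathrm{pool}}=\mathbb{E}[\mathbf{1}\{f^*_{\mathrm{pool}}(X)\ne Y\}]=\mathbb{E}_X[1-\max_k\mathbb{P}(Y=k\mid X)]$ and $R^*_{\mathrm{DI}}=\mathbb{E}[\mathbf{1}\{f^*_{\mathrm{DI}}(X,M)\ne Y\}]=\mathbb{E}_{X,M}[1-\max_k\mathbb{P}(Y=k\mid X,M)]$, both depending on $P_{XYMD}$. Point-wise margin: $\gamma(x,m)=\max_k\mathbb{P}(Y=k\mid X=x,M=m)-\operatorname{2nd}\max_k\mathbb{P}(Y=k\mid X=x,M=m)$, where $\operatorname{2nd}\max_k$ returns the second largest value counted with multiplicity (so $\gamma(x,m)=0$ if the maximum is attained by two or more labels). The function $\gamma(x,m)$ is distinct from the constant $\gamma>0$. The infimum over an empty set is $+\infty$. *)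

theory Defs
  imports "HOL-Probability.Probability"
begin

text \<open>
  \<open>\<kappa>\<close> is a (version of the) regular conditional distribution of the random variable \<open>V\<close>
  given the random variable \<open>U\<close>; here \<open>U\<close> and \<open>V\<close> live on \<open>P\<close> and take values in the
  measurable spaces \<open>SU\<close> and \<open>SV\<close>.
\<close>
definition reg_cond_distr ::
  "'a measure \<Rightarrow> 'u measure \<Rightarrow> ('a \<Rightarrow> 'u) \<Rightarrow> 'v measure \<Rightarrow> ('a \<Rightarrow> 'v) \<Rightarrow> ('u \<Rightarrow> 'v measure) \<Rightarrow> bool"
  where
  "reg_cond_distr P SU U SV V \<kappa> \<longleftrightarrow>
     \<kappa> \<in> SU \<rightarrow>\<^sub>M prob_algebra SV \<and>
     (\<forall>A\<in>sets SU. \<forall>B\<in>sets SV.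
        emeasure P {\<omega>\<in>space P. U \<omega> \<in> A \<and> V \<omega> \<in> B} =
        (\<integral>\<^sup>+ u\<in>A. emeasure (\<kappa> u) B \<partial>distr P SU U))"

text \<open>
  A joint law of \<open>(X, Y, M, D)\<close>, bundled with the versions of the conditional distributions
  that have been fixed for it and with the measurable choices of maximizers that define its two
  Bayes classifiers. The versions have to be part of the data because the margin condition below
  is imposed at every point and so depends on them.
\<close>
record ('x, 'm, 'd) model =
  law :: "('x \<times> nat \<times> 'm \<times> 'd) measure"
  cond_Y_X :: "'x \<Rightarrow> nat measure"
  cond_Y_XM :: "'x \<times> 'm \<Rightarrow> nat measure"
  cond_M_X :: "'x \<Rightarrow> 'm measure"
  cond_XY_D :: "'d \<Rightarrow> ('x \<times> nat) measure"
  cond_XY_DM :: "'d \<times> 'm \<Rightarrow> ('x \<times> nat) measure"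
  f_pool :: "'x \<Rightarrow> nat"
  f_DI :: "'x \<times> 'm \<Rightarrow> nat"

abbreviation labels :: "nat \<Rightarrow> nat measure" where
  "labels K \<equiv> count_space {1..K}"

definition bayes_classifier ::
  "nat \<Rightarrow> 'u measure \<Rightarrow> ('u \<Rightarrow> nat measure) \<Rightarrow> ('u \<Rightarrow> nat) \<Rightarrow> bool" where
  "bayes_classifier K SU \<kappa> f \<longleftrightarrow>
     f \<in> SU \<rightarrow>\<^sub>M labels K \<and>
     (\<forall>u\<in>space SU. is_arg_max (\<lambda>k. measure (\<kappa> u) {k}) (\<lambda>k. k \<in> {1..K}) (f u))"

text \<open>
  The last conjunct is the conditional independence of \<open>(X, Y)\<close> and \<open>M\<close> given \<open>D\<close>. As an
  identity between versions of conditional distributions it is required almost surely only.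
\<close>
definition is_model ::
  "nat \<Rightarrow> 'x measure \<Rightarrow> 'm measure \<Rightarrow> 'd measure \<Rightarrow> ('x, 'm, 'd) model \<Rightarrow> bool" where
  "is_model K SX SM SD \<theta> \<longleftrightarrow>
     prob_space (law \<theta>) \<and>
     sets (law \<theta>) = sets (SX \<Otimes>\<^sub>M labels K \<Otimes>\<^sub>M SM \<Otimes>\<^sub>M SD) \<and>
     reg_cond_distr (law \<theta>) SX (\<lambda>(x, y, m, d). x) (labels K) (\<lambda>(x, y, m, d). y) (cond_Y_X \<theta>) \<and>
     reg_cond_distr (law \<theta>) (SX \<Otimes>\<^sub>M SM) (\<lambda>(x, y, m, d). (x, m))
       (labels K) (\<lambda>(x, y, m, d). y) (cond_Y_XM \<theta>) \<and>
     reg_cond_distr (law \<theta>) SX (\<lambda>(x, y, m, d). x) SM (\<lambda>(x, y, m, d). m) (cond_M_X \<theta>) \<and>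
     reg_cond_distr (law \<theta>) SD (\<lambda>(x, y, m, d). d)
       (SX \<Otimes>\<^sub>M labels K) (\<lambda>(x, y, m, d). (x, y)) (cond_XY_D \<theta>) \<and>
     reg_cond_distr (law \<theta>) (SD \<Otimes>\<^sub>M SM) (\<lambda>(x, y, m, d). (d, m))
       (SX \<Otimes>\<^sub>M labels K) (\<lambda>(x, y, m, d). (x, y)) (cond_XY_DM \<theta>) \<and>
     bayes_classifier K SX (cond_Y_X \<theta>) (f_pool \<theta>) \<and>
     bayes_classifier K (SX \<Otimes>\<^sub>M SM) (cond_Y_XM \<theta>) (f_DI \<theta>) \<and>
     (AE (x, y, m, d) in law \<theta>. cond_XY_DM \<theta> (d, m) = cond_XY_D \<theta> d)"

definition risk_pool :: "('x, 'm, 'd) model \<Rightarrow> real" where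
  "risk_pool \<theta> = (\<integral>(x, y, m, d). of_bool (f_pool \<theta> x \<noteq> y) \<partial>law \<theta>)"

definition risk_DI :: "('x, 'm, 'd) model \<Rightarrow> real" where
  "risk_DI \<theta> = (\<integral>(x, y, m, d). of_bool (f_DI \<theta> (x, m) \<noteq> y) \<partial>law \<theta>)"

text \<open>The second largest of \<open>g 1, \<dots>, g K\<close>, counted with multiplicity; meaningful for \<open>K \<ge> 2\<close>.\<close>
definition second_max :: "nat \<Rightarrow> (nat \<Rightarrow> real) \<Rightarrow> real" where
  "second_max K g = rev (sort (map g [1..<Suc K])) ! 1"

definition margin :: "nat \<Rightarrow> ('x, 'm, 'd) model \<Rightarrow> 'x \<Rightarrow> 'm \<Rightarrow> real" where
  "margin K \<theta> x m =
     (let \<eta> = (\<lambda>k. measure (cond_Y_XM \<theta> (x, m)) {k}) in Max (\<eta> ` {1..K}) - second_max K \<eta>)"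

text \<open>The law of \<open>(X, M, M')\<close>, where \<open>M\<close> and \<open>M'\<close> are independent draws from \<open>P\<^bsub>M|X\<^esub>\<close> given \<open>X\<close>.\<close>
definition law_XMM' :: "'x measure \<Rightarrow> 'm measure \<Rightarrow> ('x, 'm, 'd) model \<Rightarrow> ('x \<times> 'm \<times> 'm) measure" where
  "law_XMM' SX SM \<theta> =
     distr (law \<theta>) SX (\<lambda>(x, y, m, d). x) \<bind>
       (\<lambda>x. distr (cond_M_X \<theta> x \<Otimes>\<^sub>M cond_M_X \<theta> x) (SX \<Otimes>\<^sub>M SM \<Otimes>\<^sub>M SM) (\<lambda>(m, m'). (x, m, m')))"

definition posterior_drift_class ::
  "nat \<Rightarrow> 'x measure \<Rightarrow> 'm measure \<Rightarrow> 'd measure \<Rightarrow> real \<Rightarrow> real \<Rightarrow> ('x, 'm, 'd) model set" where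
  "posterior_drift_class K SX SM SD \<gamma> \<epsilon> =
     {\<theta>. is_model K SX SM SD \<theta> \<and>
         (\<forall>x\<in>space SX. \<forall>m\<in>space SM. margin K \<theta> x m \<ge> \<gamma>) \<and>
         measure (law_XMM' SX SM \<theta>)
           {(x, m, m') \<in> space (SX \<Otimes>\<^sub>M SM \<Otimes>\<^sub>M SM). f_DI \<theta> (x, m) \<noteq> f_DI \<theta> (x, m')} \<ge> \<epsilon>}"

end

theory Submission imports Defs begin

text \<open>
  Given \<open>(X, M) = (x, m)\<close>, predicting any label other than \<open>f_DI (x, m)\<close> costs at least the margin
  in conditional accuracy, so the risk difference is at least \<open>\<gamma>\<close> times the probability that
  \<open>f_pool X \<noteq> f_DI (X, M)\<close>. If \<open>f_DI (X, M) \<noteq> f_DI (X, M')\<close>, then \<open>f_pool X\<close> differs from at least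
  one of the two; as \<open>(X, M)\<close> and \<open>(X, M')\<close> have the same law, that probability is at least
  \<open>\<epsilon> / 2\<close>.
\<close>

section \<open>The second largest value, counted with multiplicity\<close>

text \<open>Distinct labels occupy distinct positions of the sorted list, even if their values tie,
  so at most one of them sits at the top position. Applied with \<open>k\<close> a maximizer, this
  bounds the value of any other label by the second maximum.\<close>

lemma second_max_ge_min:
  assumes "j \<in> {1..K}" "k \<in> {1..K}" "j \<noteq> k"
  shows "min (g j) (g k) \<le> second_max K g"
proof -
  define xs where "xs = map g [1..<Suc K]"
  define ys where "ys = sort xs"
  have len: "length xs = K" "length ys = K"
    by (simp_all add: xs_def ys_def del: upt_Suc)
  have "mset ys = mset xs" by (simp add: ys_def)
  \<comment> \<open>The permutation remembers which label each sorted entry comes from. Values alone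
    would not give different positions when \<open>g j = g k\<close>.\<close>
  then obtain p where p: "p permutes {..<K}" "permute_list p xs = ys"
    using len by (metis mset_eq_permutation)
  have at: "\<exists>a<K. ys ! a = g i \<and> p a = i - 1" if "i \<in> {1..K}" for i
  proof -
    \<comment> \<open>Labels start at 1 and list positions at 0, so label \<open>i\<close> sits at
      index \<open>i - 1\<close> of \<open>xs\<close>.\<close>
    have i: "i - 1 < K" using that by auto
    then have "i - 1 \<in> p ` {..<K}" using permutes_image[OF p(1)] by simp
    then obtain a where a: "a < K" "p a = i - 1" by auto
    have "ys ! a = xs ! (i - 1)"
      using permute_list_nth[of p xs a] p a len by simp
    also have "\<dots> = g i" using that i by (simp add: xs_def del: upt_Suc)
    finally show ?thesis using a by blast
  qed
  obtain a where a: "a < K" "ys ! a = g j" "p a = j - 1"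
    using at[OF assms(1)] by blast
  obtain b where b: "b < K" "ys ! b = g k" "p b = k - 1"
    using at[OF assms(2)] by blast
  have "j - 1 \<noteq> k - 1" using assms by auto
  then have "a \<noteq> b" using a(3) b(3) by metis
  then have le: "min a b \<le> K - 2" and "1 < K"
    using a(1) b(1) by linarith+
  have "second_max K g = rev ys ! 1"
    by (simp only: second_max_def ys_def xs_def)
  \<comment> \<open>\<open>sort\<close> is ascending, so index 1 of the reversed list is the last
    but one of the positions \<open>0\<close> to \<open>K - 1\<close>.\<close>
  also have "\<dots> = ys ! (K - 2)"
    using \<open>1 < K\<close> len by (simp add: rev_nth numeral_2_eq_2)
  finally have "ys ! (min a b) \<le> second_max K g"
    using sorted_nth_mono[of ys, OF _ le] \<open>1 < K\<close> len by (simp add: ys_def)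
  then show ?thesis
    unfolding a(2)[symmetric] b(2)[symmetric] by (auto simp: min_def split: if_splits)
qed

section \<open>Disintegration of a joint law\<close>

text \<open>
  The defining identity of a conditional distribution extends from rectangles, which generate
  the product \<open>\<sigma>\<close>-algebra and are closed under intersection, to all measurable sets.
\<close>
lemma reg_cond_distr_disintegration:
  assumes "prob_space P" and U [measurable]: "U \<in> P \<rightarrow>\<^sub>M SU" and V [measurable]: "V \<in> P \<rightarrow>\<^sub>M SV"
    and \<kappa>: "reg_cond_distr P SU U SV V \<kappa>"
    and A: "A \<in> sets (SU \<Otimes>\<^sub>M SV)"
  shows "emeasure P {\<omega>\<in>space P. (U \<omega>, V \<omega>) \<in> A} =
    (\<integral>\<^sup>+ u. emeasure (\<kappa> u) (Pair u -` A) \<partial>distr P SU U)"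
proof -
  interpret prob_space P by fact
  have [measurable]: "\<kappa> \<in> SU \<rightarrow>\<^sub>M prob_algebra SV"
    using \<kappa> by (simp add: reg_cond_distr_def)
  have \<kappa>_space: "sets (\<kappa> u) = sets SV" if "u \<in> space SU" for u
    using measurable_space[OF \<open>\<kappa> \<in> _\<close> that] by (simp add: space_prob_algebra)
  \<comment> \<open>\<open>L u\<close> is the law of the pair \<open>(u, v)\<close> with
    \<open>v\<close> drawn from \<open>\<kappa> u\<close>, and \<open>N\<close> mixes these over the
    law of \<open>U\<close>. The aim is that \<open>N\<close> is the joint law of \<open>U\<close>
    and \<open>V\<close>.\<close>
  define L where "L u = distr (\<kappa> u) (SU \<Otimes>\<^sub>M SV) (Pair u)" for u
  define N where "N = distr P SU U \<bind> L"
  have L: "L \<in> distr P SU U \<rightarrow>\<^sub>M subprob_algebra (SU \<Otimes>\<^sub>M SV)"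
    unfolding L_def by (rule measurable_prob_algebraD) measurable
  have ne: "space (distr P SU U) \<noteq> {}"
    using not_empty measurable_space[OF U] by auto
  have sets_N: "sets N = sets (SU \<Otimes>\<^sub>M SV)"
    unfolding N_def by (rule sets_bind) (use L ne in \<open>auto simp: L_def\<close>)
  have N: "emeasure N B = (\<integral>\<^sup>+ u. emeasure (\<kappa> u) (Pair u -` B) \<partial>distr P SU U)"
    if B: "B \<in> sets (SU \<Otimes>\<^sub>M SV)" for B
  proof -
    have "emeasure N B = (\<integral>\<^sup>+ u. emeasure (L u) B \<partial>distr P SU U)"
      unfolding N_def using emeasure_bind[OF ne L B] .
    also have "\<dots> = (\<integral>\<^sup>+ u. emeasure (\<kappa> u) (Pair u -` B) \<partial>distr P SU U)"
    proof (rule nn_integral_cong)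
      fix u assume "u \<in> space (distr P SU U)"
      then have u: "u \<in> space SU" by simp
      have "Pair u \<in> \<kappa> u \<rightarrow>\<^sub>M SU \<Otimes>\<^sub>M SV"
        using u by (simp add: measurable_cong_sets[OF \<kappa>_space[OF u] refl])
      moreover have "Pair u -` B \<subseteq> space (\<kappa> u)"
        using sets.sets_into_space[OF B] sets_eq_imp_space_eq[OF \<kappa>_space[OF u]]
        by (auto simp: space_pair_measure)
      ultimately show "emeasure (L u) B = emeasure (\<kappa> u) (Pair u -` B)"
        using B by (simp add: L_def emeasure_distr Int_absorb2)
    qed
    finally show ?thesis .
  qed
  let ?E = "{a \<times> b | a b. a \<in> sets SU \<and> b \<in> sets SV}"
  \<comment> \<open>Uniqueness of measures on an intersection-stable generator. The exhausting
    sequence may be constant because the total mass is finite.\<close>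
  have "distr P (SU \<Otimes>\<^sub>M SV) (\<lambda>\<omega>. (U \<omega>, V \<omega>)) = N"
  proof (rule measure_eqI_generator_eq[OF Int_stable_pair_measure_generator[of SU SV],
        where A = "\<lambda>_. space SU \<times> space SV" and \<Omega> = "space SU \<times> space SV"])
    show "?E \<subseteq> Pow (space SU \<times> space SV)"
      using sets.space_closed[of SU] sets.space_closed[of SV] by auto
    fix B assume "B \<in> ?E"
    then obtain a b where B: "B = a \<times> b" and [measurable]: "a \<in> sets SU" "b \<in> sets SV" by auto
    have "emeasure (distr P (SU \<Otimes>\<^sub>M SV) (\<lambda>\<omega>. (U \<omega>, V \<omega>))) B =
        emeasure P {\<omega>\<in>space P. U \<omega> \<in> a \<and> V \<omega> \<in> b}"
      unfolding B by (subst emeasure_distr) (auto intro!: arg_cong2[where f = emeasure])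
    also have "\<dots> = (\<integral>\<^sup>+ u\<in>a. emeasure (\<kappa> u) b \<partial>distr P SU U)"
      using \<kappa> by (simp add: reg_cond_distr_def)
    \<comment> \<open>The section of \<open>a \<times> b\<close> at \<open>u\<close> is
      \<open>b\<close> if \<open>u\<close> lies in \<open>a\<close> and empty otherwise, which
      produces the restricted integral.\<close>
    also have "\<dots> = emeasure N B"
      unfolding B by (subst N) (auto intro!: nn_integral_cong simp: indicator_def)
    finally show "emeasure (distr P (SU \<Otimes>\<^sub>M SV) (\<lambda>\<omega>. (U \<omega>, V \<omega>))) B = emeasure N B" .
  next
    show "emeasure (distr P (SU \<Otimes>\<^sub>M SV) (\<lambda>\<omega>. (U \<omega>, V \<omega>))) (space SU \<times> space SV) \<noteq> \<infinity>"
      by (subst emeasure_distr) auto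
  qed (auto simp: sets_N sets_pair_measure)
  then have "emeasure N A = emeasure P ((\<lambda>\<omega>. (U \<omega>, V \<omega>)) -` A \<inter> space P)"
    using A by (auto simp: emeasure_distr)
  also have "(\<lambda>\<omega>. (U \<omega>, V \<omega>)) -` A \<inter> space P = {\<omega>\<in>space P. (U \<omega>, V \<omega>) \<in> A}" by auto
  finally show ?thesis using N[OF A] by simp
qed

section \<open>Events and kernels with finitely many labels\<close>

text \<open>There are only finitely many labels, so the event is the finite union over
  \<open>k\<close> of the events that both maps take the value \<open>k\<close>.\<close>

lemma sets_Collect_eq_labels:
  assumes "f \<in> M \<rightarrow>\<^sub>M labels K" "g \<in> M \<rightarrow>\<^sub>M labels K"
  shows "{x\<in>space M. f x = g x} \<in> sets M"
proof -
  have "f -` {k} \<inter> space M \<in> sets M" "g -` {k} \<inter> space M \<in> sets M" if "k \<in> {1..K}" for k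
    using that by (auto intro!: measurable_sets[OF assms(1)] measurable_sets[OF assms(2)])
  then have "(\<Union>k\<in>{1..K}. (f -` {k} \<inter> space M) \<inter> (g -` {k} \<inter> space M)) \<in> sets M"
    by (intro sets.finite_UN) auto
  also have "(\<Union>k\<in>{1..K}. (f -` {k} \<inter> space M) \<inter> (g -` {k} \<inter> space M)) = {x\<in>space M. f x = g x}"
    using measurable_space[OF assms(1)] by fastforce
  finally show ?thesis .
qed

lemma sets_Collect_neq_labels:
  assumes "f \<in> M \<rightarrow>\<^sub>M labels K" "g \<in> M \<rightarrow>\<^sub>M labels K"
  shows "{x\<in>space M. f x \<noteq> g x} \<in> sets M"
  using sets_Collect_eq_labels[OF assms] by (rule sets.sets_Collect_neg)

text \<open>The set \<open>{h u}\<close> moves with \<open>u\<close>, but it is the section at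
  \<open>u\<close> of the graph of \<open>h\<close>, which is measurable in the product.\<close>

lemma borel_measurable_kernel_label:
  assumes \<kappa>: "\<kappa> \<in> SU \<rightarrow>\<^sub>M prob_algebra (labels K)" and h [measurable]: "h \<in> SU \<rightarrow>\<^sub>M labels K"
  shows "(\<lambda>u. emeasure (\<kappa> u) {h u}) \<in> borel_measurable SU"
proof (rule emeasure_measurable_subprob_algebra2[OF _ measurable_prob_algebraD[OF \<kappa>]])
  have "{z \<in> space (SU \<Otimes>\<^sub>M labels K). snd z = h (fst z)} \<in> sets (SU \<Otimes>\<^sub>M labels K)"
    by (rule sets_Collect_eq_labels) measurable
  moreover have "{z \<in> space (SU \<Otimes>\<^sub>M labels K). snd z = h (fst z)} = (SIGMA u:space SU. {h u})"
    using measurable_space[OF h] by (force simp: space_pair_measure)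
  ultimately show "(SIGMA u:space SU. {h u}) \<in> sets (SU \<Otimes>\<^sub>M labels K)" by simp
qed

text \<open>Disintegration applied to the graph of \<open>h\<close>. For a classifier
  \<open>h\<close> it expresses the accuracy as the mean conditional probability of the predicted
  label.\<close>

lemma emeasure_label_eq:
  assumes "prob_space P" and [measurable]: "U \<in> P \<rightarrow>\<^sub>M SU" "V \<in> P \<rightarrow>\<^sub>M labels K"
    and \<kappa>: "reg_cond_distr P SU U (labels K) V \<kappa>"
    and [measurable]: "h \<in> SU \<rightarrow>\<^sub>M labels K"
  shows "emeasure P {\<omega>\<in>space P. V \<omega> = h (U \<omega>)} = (\<integral>\<^sup>+ u. emeasure (\<kappa> u) {h u} \<partial>distr P SU U)"
proof -
  let ?A = "{z \<in> space (SU \<Otimes>\<^sub>M labels K). snd z = h (fst z)}"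
  have A: "?A \<in> sets (SU \<Otimes>\<^sub>M labels K)"
    by (rule sets_Collect_eq_labels) measurable
  have "emeasure P {\<omega>\<in>space P. V \<omega> = h (U \<omega>)} = emeasure P {\<omega>\<in>space P. (U \<omega>, V \<omega>) \<in> ?A}"
    using measurable_space[OF assms(2)] measurable_space[OF assms(3)]
    by (intro arg_cong2[where f = emeasure]) (auto simp: space_pair_measure)
  also have "\<dots> = (\<integral>\<^sup>+ u. emeasure (\<kappa> u) (Pair u -` ?A) \<partial>distr P SU U)"
    by (rule reg_cond_distr_disintegration[OF assms(1-4) A])
  also have "\<dots> = (\<integral>\<^sup>+ u. emeasure (\<kappa> u) {h u} \<partial>distr P SU U)"
    using measurable_space[OF assms(5)]
    by (intro nn_integral_cong arg_cong2[where f = emeasure]) (auto simp: space_pair_measure)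
  finally show ?thesis .
qed

section \<open>Margin, disagreement and accuracy\<close>

text \<open>The maximum is attained at \<open>j\<close>, and the smaller of the values at
  \<open>k\<close> and \<open>j\<close> is the one at \<open>k\<close>, so the latter is at most the
  second maximum.\<close>

lemma margin_le_diff:
  assumes "is_arg_max (\<lambda>k. measure (cond_Y_XM \<theta> (x, m)) {k}) (\<lambda>k. k \<in> {1..K}) j"
    and "k \<in> {1..K}" "k \<noteq> j"
  shows "margin K \<theta> x m \<le> measure (cond_Y_XM \<theta> (x, m)) {j} - measure (cond_Y_XM \<theta> (x, m)) {k}"
proof -
  define \<eta> where "\<eta> k = measure (cond_Y_XM \<theta> (x, m)) {k}" for k
  have j: "j \<in> {1..K}" and le: "\<And>i. i \<in> {1..K} \<Longrightarrow> \<eta> i \<le> \<eta> j"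
    using assms(1) by (auto simp: is_arg_max_linorder \<eta>_def)
  have "Max (\<eta> ` {1..K}) = \<eta> j"
    using j le by (intro Max_eqI) auto
  moreover have "\<eta> k \<le> second_max K \<eta>"
    using second_max_ge_min[of k K j \<eta>] j le[OF assms(2)] assms(2,3) by (simp add: min_absorb1)
  moreover have "margin K \<theta> x m = Max (\<eta> ` {1..K}) - second_max K \<eta>"
    by (simp add: margin_def Let_def \<eta>_def[abs_def])
  ultimately show ?thesis
    unfolding \<eta>_def[of j, symmetric] \<eta>_def[of k, symmetric] by linarith
qed

text \<open>Both draws are compared with the same label \<open>g x\<close>, since \<open>g\<close>
  sees only \<open>x\<close>. The factor 2 is a union bound over the two draws, each of which has
  conditional law \<open>cond_M_X \<theta> x\<close>.\<close>

lemma emeasure_law_XMM'_disagree_le: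
  assumes P: "prob_space (law \<theta>)"
    and X [measurable]: "(\<lambda>(x, y, m, d). x) \<in> law \<theta> \<rightarrow>\<^sub>M SX"
    and M [measurable]: "(\<lambda>(x, y, m, d). m) \<in> law \<theta> \<rightarrow>\<^sub>M SM"
    and \<kappa>: "reg_cond_distr (law \<theta>) SX (\<lambda>(x, y, m, d). x) SM (\<lambda>(x, y, m, d). m) (cond_M_X \<theta>)"
    and f [measurable]: "f \<in> SX \<Otimes>\<^sub>M SM \<rightarrow>\<^sub>M labels K"
    and g [measurable]: "g \<in> SX \<rightarrow>\<^sub>M labels K"
  shows "emeasure (law_XMM' SX SM \<theta>)
      {(x, m, m') \<in> space (SX \<Otimes>\<^sub>M SM \<Otimes>\<^sub>M SM). f (x, m) \<noteq> f (x, m')} \<le>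
    2 * emeasure (law \<theta>) {(x, y, m, d) \<in> space (law \<theta>). f (x, m) \<noteq> g x}"
proof -
  interpret prob_space "law \<theta>" by fact
  let ?PX = "distr (law \<theta>) SX (\<lambda>(x, y, m, d). x)" and ?\<kappa> = "cond_M_X \<theta>"
  let ?S = "{(x, m, m') \<in> space (SX \<Otimes>\<^sub>M SM \<Otimes>\<^sub>M SM). f (x, m) \<noteq> f (x, m')}"
  let ?A = "{z \<in> space (SX \<Otimes>\<^sub>M SM). f z \<noteq> g (fst z)}"
  define L where "L x = distr (?\<kappa> x \<Otimes>\<^sub>M ?\<kappa> x) (SX \<Otimes>\<^sub>M SM \<Otimes>\<^sub>M SM) (\<lambda>(m, m'). (x, m, m'))" for x
  have \<kappa>_meas: "?\<kappa> \<in> SX \<rightarrow>\<^sub>M prob_algebra SM"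
    using \<kappa> by (simp add: reg_cond_distr_def)
  note \<kappa>_sub [measurable] = measurable_prob_algebraD[OF \<kappa>_meas]
  \<comment> \<open>Measurability of \<open>L\<close> in \<open>x\<close> requires the map to be
    jointly measurable in the parameter \<open>x\<close> and the pair; uncurried, it is the
    identity.\<close>
  have "(\<lambda>(x, m, m'). (x, m, m')) \<in> SX \<Otimes>\<^sub>M SM \<Otimes>\<^sub>M SM \<rightarrow>\<^sub>M SX \<Otimes>\<^sub>M SM \<Otimes>\<^sub>M SM"
    by measurable
  from measurable_distr2[OF this measurable_pair_measure[OF \<kappa>_sub \<kappa>_sub]]
  have L: "L \<in> ?PX \<rightarrow>\<^sub>M subprob_algebra (SX \<Otimes>\<^sub>M SM \<Otimes>\<^sub>M SM)"
    unfolding L_def measurable_distr_eq1 .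
  have "{z \<in> space (SX \<Otimes>\<^sub>M SM \<Otimes>\<^sub>M SM). f (fst z, fst (snd z)) \<noteq> f (fst z, snd (snd z))}
      \<in> sets (SX \<Otimes>\<^sub>M SM \<Otimes>\<^sub>M SM)"
    by (rule sets_Collect_neq_labels[where K = K]) measurable
  then have S: "?S \<in> sets (SX \<Otimes>\<^sub>M SM \<Otimes>\<^sub>M SM)"
    by (simp add: case_prod_unfold)
  have A: "?A \<in> sets (SX \<Otimes>\<^sub>M SM)"
    by (rule sets_Collect_neq_labels) measurable
  have le: "emeasure (L x) ?S \<le> 2 * emeasure (?\<kappa> x) (Pair x -` ?A)" if x: "x \<in> space SX" for x
  proof -
    interpret \<kappa>: prob_space "?\<kappa> x"
      using measurable_space[OF \<kappa>_meas x] by (simp add: space_prob_algebra)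
    have \<kappa>_sets [measurable_cong]: "sets (?\<kappa> x) = sets SM"
      using measurable_space[OF \<kappa>_meas x] by (simp add: space_prob_algebra)
    have \<kappa>_space: "space (?\<kappa> x) = space SM"
      using \<kappa>_sets by (rule sets_eq_imp_space_eq)
    define B where "B = Pair x -` ?A"
    have B: "B \<in> sets (?\<kappa> x)"
      using sets_Pair1[OF A, of x] by (simp add: \<kappa>_sets B_def)
    have "emeasure (L x) ?S =
        emeasure (?\<kappa> x \<Otimes>\<^sub>M ?\<kappa> x) ((\<lambda>(m, m'). (x, m, m')) -` ?S \<inter> space (?\<kappa> x \<Otimes>\<^sub>M ?\<kappa> x))"
      unfolding L_def
    proof (rule emeasure_distr[OF _ S])
      show "(\<lambda>(m, m'). (x, m, m')) \<in> ?\<kappa> x \<Otimes>\<^sub>M ?\<kappa> x \<rightarrow>\<^sub>M SX \<Otimes>\<^sub>M SM \<Otimes>\<^sub>M SM"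
        using x by measurable
    qed
    \<comment> \<open>If neither \<open>m\<close> nor \<open>m'\<close> lies in \<open>B\<close>,
      both predictions equal \<open>g x\<close> and hence agree.\<close>
    also have "\<dots> \<le> emeasure (?\<kappa> x \<Otimes>\<^sub>M ?\<kappa> x) (B \<times> space (?\<kappa> x) \<union> space (?\<kappa> x) \<times> B)"
      using x by (intro emeasure_mono sets.Un pair_measureI B sets.top)
        (auto simp: space_pair_measure \<kappa>_space B_def)
    also have "\<dots> \<le> emeasure (?\<kappa> x \<Otimes>\<^sub>M ?\<kappa> x) (B \<times> space (?\<kappa> x)) + emeasure (?\<kappa> x \<Otimes>\<^sub>M ?\<kappa> x) (space (?\<kappa> x) \<times> B)"
      by (intro emeasure_subadditive pair_measureI B sets.top)
    \<comment> \<open>Each strip has the mass of \<open>B\<close>, as the other factor is a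
      probability measure.\<close>
    also have "\<dots> = 2 * emeasure (?\<kappa> x) B"
      by (simp add: B \<kappa>.emeasure_pair_measure_Times \<kappa>.emeasure_space_1 mult_2)
    finally show ?thesis by (simp only: B_def)
  qed
  have "emeasure (law_XMM' SX SM \<theta>) ?S = (\<integral>\<^sup>+ x. emeasure (L x) ?S \<partial>?PX)"
    unfolding law_XMM'_def L_def[symmetric]
  proof (rule emeasure_bind[OF _ L S])
    from not_empty obtain \<omega> where "\<omega> \<in> space (law \<theta>)" by blast
    from measurable_space[OF X this] show "space ?PX \<noteq> {}"
      unfolding space_distr by blast
  qed
  also have "\<dots> \<le> (\<integral>\<^sup>+ x. 2 * emeasure (?\<kappa> x) (Pair x -` ?A) \<partial>?PX)"
    by (intro nn_integral_mono le) simp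
  also have "\<dots> = 2 * (\<integral>\<^sup>+ x. emeasure (?\<kappa> x) (Pair x -` ?A) \<partial>?PX)"
  proof (intro nn_integral_cmult)
    have "(SIGMA x:space SX. Pair x -` ?A) = ?A"
      unfolding space_pair_measure by blast
    with A have "(SIGMA x:space SX. Pair x -` ?A) \<in> sets (SX \<Otimes>\<^sub>M SM)" by (simp only:)
    from emeasure_measurable_subprob_algebra2[OF this \<kappa>_sub]
    show "(\<lambda>x. emeasure (?\<kappa> x) (Pair x -` ?A)) \<in> borel_measurable ?PX"
      by (simp only: measurable_distr_eq1)
  qed
  \<comment> \<open>Disintegration read backwards returns from the kernel to the law of
    \<open>(X, M)\<close>.\<close>
  also have "(\<integral>\<^sup>+ x. emeasure (?\<kappa> x) (Pair x -` ?A) \<partial>?PX) =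
      emeasure (law \<theta>) {\<omega> \<in> space (law \<theta>). ((\<lambda>(x, y, m, d). x) \<omega>, (\<lambda>(x, y, m, d). m) \<omega>) \<in> ?A}"
    by (rule reg_cond_distr_disintegration[OF P X M \<kappa> A, symmetric])
  also have "{\<omega> \<in> space (law \<theta>). ((\<lambda>(x, y, m, d). x) \<omega>, (\<lambda>(x, y, m, d). m) \<omega>) \<in> ?A} =
      {(x, y, m, d) \<in> space (law \<theta>). f (x, m) \<noteq> g x}"
  proof -
    have "x \<in> space SX \<and> m \<in> space SM" if "(x, y, m, d) \<in> space (law \<theta>)" for x y m d
      using measurable_space[OF X that] measurable_space[OF M that] by simp
    then show ?thesis by (auto simp: space_pair_measure)
  qed
  finally show ?thesis .
qed

text \<open>Given \<open>(x, m)\<close>, the conditional accuracies differ by at least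
  \<open>\<gamma>\<close> where the predictions differ and by 0 where they agree; integrating gives
  the claim. The form is additive because subtraction in \<open>ennreal\<close> truncates.\<close>

lemma accuracy_gain:
  assumes \<theta>: "is_model K SX SM SD \<theta>" and "\<gamma> \<ge> 0"
    and margin: "\<And>x m. x \<in> space SX \<Longrightarrow> m \<in> space SM \<Longrightarrow> margin K \<theta> x m \<ge> \<gamma>"
    and g [measurable]: "g \<in> SX \<rightarrow>\<^sub>M labels K"
  shows "emeasure (law \<theta>) {(x, y, m, d) \<in> space (law \<theta>). y = g x} +
      ennreal \<gamma> * emeasure (law \<theta>) {(x, y, m, d) \<in> space (law \<theta>). f_DI \<theta> (x, m) \<noteq> g x} \<le>
    emeasure (law \<theta>) {(x, y, m, d) \<in> space (law \<theta>). y = f_DI \<theta> (x, m)}"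
proof -
  interpret prob_space "law \<theta>" using \<theta> by (simp add: is_model_def)
  let ?P = "law \<theta>" and ?f = "f_DI \<theta>" and ?\<kappa> = "cond_Y_XM \<theta>"
  let ?U = "\<lambda>(x, y, m, d). (x, m)" and ?V = "\<lambda>(x, y, m, d). y"
  let ?PU = "distr ?P (SX \<Otimes>\<^sub>M SM) ?U"
  let ?A = "{u \<in> space (SX \<Otimes>\<^sub>M SM). ?f u \<noteq> g (fst u)}"
  have [measurable_cong]: "sets ?P = sets (SX \<Otimes>\<^sub>M labels K \<Otimes>\<^sub>M SM \<Otimes>\<^sub>M SD)"
    using \<theta> by (simp add: is_model_def)
  have U [measurable]: "?U \<in> ?P \<rightarrow>\<^sub>M SX \<Otimes>\<^sub>M SM" and V [measurable]: "?V \<in> ?P \<rightarrow>\<^sub>M labels K"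
    by measurable
  have \<kappa>: "reg_cond_distr ?P (SX \<Otimes>\<^sub>M SM) ?U (labels K) ?V ?\<kappa>"
    and f [measurable]: "?f \<in> SX \<Otimes>\<^sub>M SM \<rightarrow>\<^sub>M labels K"
    and argmax: "\<And>u. u \<in> space (SX \<Otimes>\<^sub>M SM) \<Longrightarrow>
      is_arg_max (\<lambda>k. measure (?\<kappa> u) {k}) (\<lambda>k. k \<in> {1..K}) (?f u)"
    using \<theta> by (simp_all add: is_model_def bayes_classifier_def)
  have \<kappa>_meas: "?\<kappa> \<in> SX \<Otimes>\<^sub>M SM \<rightarrow>\<^sub>M prob_algebra (labels K)"
    using \<kappa> by (simp add: reg_cond_distr_def)
  have A [measurable]: "?A \<in> sets (SX \<Otimes>\<^sub>M SM)"
    by (rule sets_Collect_neq_labels) measurable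
  \<comment> \<open>The pointwise inequality. Where the two predictions coincide, the indicator
    vanishes and both sides are equal.\<close>
  have le: "emeasure (?\<kappa> u) {g (fst u)} + ennreal \<gamma> * indicator ?A u \<le> emeasure (?\<kappa> u) {?f u}"
    if u: "u \<in> space (SX \<Otimes>\<^sub>M SM)" for u
  proof (cases "?f u = g (fst u)")
    case False
    interpret \<kappa>: prob_space "?\<kappa> u"
      using measurable_space[OF \<kappa>_meas u] by (simp add: space_prob_algebra)
    obtain x m where xm: "u = (x, m)" "x \<in> space SX" "m \<in> space SM"
      using u by (auto simp: space_pair_measure)
    have "\<gamma> \<le> measure (?\<kappa> (x, m)) {?f (x, m)} - measure (?\<kappa> (x, m)) {g x}"
      using margin_le_diff[of \<theta> x m K "?f u" "g x"] argmax[OF u] margin[of x m]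
        measurable_space[OF g, of x] False xm by auto
    then show ?thesis
      using False u xm \<open>\<gamma> \<ge> 0\<close>
      by (simp add: \<kappa>.emeasure_eq_measure[unfolded xm] flip: ennreal_plus)
  qed simp
  have "emeasure ?P {(x, y, m, d) \<in> space ?P. y = g x} = emeasure ?P {\<omega> \<in> space ?P. ?V \<omega> = g (fst (?U \<omega>))}"
    by (intro arg_cong2[where f = emeasure]) auto
  also have "\<dots> = (\<integral>\<^sup>+ u. emeasure (?\<kappa> u) {g (fst u)} \<partial>?PU)"
    by (rule emeasure_label_eq[OF prob_space_axioms U V \<kappa>]) measurable
  moreover have "emeasure ?P {(x, y, m, d) \<in> space ?P. ?f (x, m) \<noteq> g x} = emeasure ?PU ?A"
    using measurable_space[OF U]
    by (subst emeasure_distr) (auto intro!: arg_cong2[where f = emeasure])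
  moreover have "emeasure ?P {(x, y, m, d) \<in> space ?P. y = ?f (x, m)} = (\<integral>\<^sup>+ u. emeasure (?\<kappa> u) {?f u} \<partial>?PU)"
    using emeasure_label_eq[OF prob_space_axioms U V \<kappa> f] by (simp add: case_prod_unfold)
  moreover have "(\<integral>\<^sup>+ u. emeasure (?\<kappa> u) {g (fst u)} \<partial>?PU) + ennreal \<gamma> * emeasure ?PU ?A =
      (\<integral>\<^sup>+ u. emeasure (?\<kappa> u) {g (fst u)} + ennreal \<gamma> * indicator ?A u \<partial>?PU)"
    by (subst nn_integral_add)
      (auto simp: nn_integral_cmult_indicator
        intro!: borel_measurable_kernel_label[OF \<kappa>_meas] measurable_compose[OF measurable_fst g])
  moreover have "\<dots> \<le> (\<integral>\<^sup>+ u. emeasure (?\<kappa> u) {?f u} \<partial>?PU)"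
    by (intro nn_integral_mono le) simp
  ultimately show ?thesis by (simp only:)
qed

section \<open>From accuracies to the risk difference\<close>

theorem theorem2:
  fixes K :: nat and SX :: "'x measure" and SM :: "'m measure" and SD :: "'d measure"
    and \<gamma> \<epsilon> :: real
  assumes "K \<ge> 2" and "\<gamma> > 0" and "\<epsilon> > 0"
  shows "(INF \<theta> \<in> posterior_drift_class K SX SM SD \<gamma> \<epsilon>. ereal (risk_pool \<theta> - risk_DI \<theta>))
           \<ge> ereal (\<gamma> * \<epsilon> / 2)"
\<comment> \<open>A bound for each single model suffices; over an empty class the infimum in
  \<open>ereal\<close> is plus infinity.\<close>
proof (rule INF_greatest)
  fix \<theta> assume "\<theta> \<in> posterior_drift_class K SX SM SD \<gamma> \<epsilon>"
  then have \<theta>: "is_model K SX SM SD \<theta>"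
    and margin: "\<And>x m. x \<in> space SX \<Longrightarrow> m \<in> space SM \<Longrightarrow> margin K \<theta> x m \<ge> \<gamma>"
    and \<epsilon>: "measure (law_XMM' SX SM \<theta>)
      {(x, m, m') \<in> space (SX \<Otimes>\<^sub>M SM \<Otimes>\<^sub>M SM). f_DI \<theta> (x, m) \<noteq> f_DI \<theta> (x, m')} \<ge> \<epsilon>"
    by (auto simp: posterior_drift_class_def)
  interpret prob_space "law \<theta>" using \<theta> by (simp add: is_model_def)
  let ?P = "law \<theta>" and ?f = "f_DI \<theta>" and ?g = "f_pool \<theta>"
  have [measurable_cong]: "sets ?P = sets (SX \<Otimes>\<^sub>M labels K \<Otimes>\<^sub>M SM \<Otimes>\<^sub>M SD)"
    using \<theta> by (simp add: is_model_def)
  have f [measurable]: "?f \<in> SX \<Otimes>\<^sub>M SM \<rightarrow>\<^sub>M labels K" and g [measurable]: "?g \<in> SX \<rightarrow>\<^sub>M labels K"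
    and \<kappa>: "reg_cond_distr ?P SX (\<lambda>(x, y, m, d). x) SM (\<lambda>(x, y, m, d). m) (cond_M_X \<theta>)"
    using \<theta> by (simp_all add: is_model_def bayes_classifier_def)
  \<comment> \<open>Risk is one minus accuracy. The form with \<open>h x m\<close> serves both
    classifiers, the pooled one being constant in \<open>m\<close>.\<close>
  have risk: "(\<integral>(x, y, m, d). of_bool (h x m \<noteq> y) \<partial>?P) =
      1 - measure ?P {(x, y, m, d) \<in> space ?P. y = h x m}"
    if [measurable]: "case_prod h \<in> SX \<Otimes>\<^sub>M SM \<rightarrow>\<^sub>M labels K" for h
  proof -
    let ?E = "{(x, y, m, d) \<in> space ?P. y = h x m}"
    have "{\<omega> \<in> space ?P. (\<lambda>(x, y, m, d). y) \<omega> = case_prod h ((\<lambda>(x, y, m, d). (x, m)) \<omega>)} \<in> sets ?P"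
      by (rule sets_Collect_eq_labels[where K = K]) measurable
    also have "{\<omega> \<in> space ?P. (\<lambda>(x, y, m, d). y) \<omega> = case_prod h ((\<lambda>(x, y, m, d). (x, m)) \<omega>)} = ?E"
      by auto
    finally have "?E \<in> sets ?P" .
    have "(\<integral>(x, y, m, d). of_bool (h x m \<noteq> y) \<partial>?P) = (\<integral>\<omega>. indicator (space ?P - ?E) \<omega> \<partial>?P)"
      by (intro Bochner_Integration.integral_cong) (auto simp: indicator_def)
    also have "\<dots> = measure ?P (space ?P - ?E)"
      by (subst Bochner_Integration.integral_indicator) (simp add: Int_absorb2)
    also have "\<dots> = 1 - measure ?P ?E"
      using prob_compl[OF \<open>?E \<in> sets ?P\<close>] .
    finally show ?thesis .
  qed
  let ?D = "{(x, y, m, d) \<in> space ?P. ?f (x, m) \<noteq> ?g x}"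
  have "emeasure (law_XMM' SX SM \<theta>)
      {(x, m, m') \<in> space (SX \<Otimes>\<^sub>M SM \<Otimes>\<^sub>M SM). ?f (x, m) \<noteq> ?f (x, m')} \<le> ennreal (2 * measure ?P ?D)"
    using emeasure_law_XMM'_disagree_le[OF prob_space_axioms _ _ \<kappa> f g]
    by (simp add: emeasure_eq_measure ennreal_mult)
  \<comment> \<open>Here \<open>measure\<close> is \<open>enn2real\<close> of
    \<open>emeasure\<close>, so a finite nonnegative bound on the latter carries over to the
    former.\<close>
  with \<epsilon> have "\<epsilon> \<le> 2 * measure ?P ?D"
    by (smt (verit) enn2real_leI measure_def measure_nonneg)
  then have "\<gamma> * \<epsilon> / 2 \<le> \<gamma> * measure ?P ?D"
    using \<open>\<gamma> > 0\<close> by simp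
  moreover have "measure ?P {(x, y, m, d) \<in> space ?P. y = ?g x} + \<gamma> * measure ?P ?D
      \<le> measure ?P {(x, y, m, d) \<in> space ?P. y = ?f (x, m)}"
    using accuracy_gain[OF \<theta> _ margin g] \<open>\<gamma> > 0\<close>
    by (simp add: emeasure_eq_measure flip: ennreal_mult ennreal_plus)
  moreover have "risk_pool \<theta> = 1 - measure ?P {(x, y, m, d) \<in> space ?P. y = ?g x}"
    unfolding risk_pool_def by (rule risk[of "\<lambda>x m. ?g x"]) measurable
  moreover have "risk_DI \<theta> = 1 - measure ?P {(x, y, m, d) \<in> space ?P. y = ?f (x, m)}"
    unfolding risk_DI_def by (rule risk[of "\<lambda>x m. ?f (x, m)"]) (use f in simp)
  ultimately show "ereal (\<gamma> * \<epsilon> / 2) \<le> ereal (risk_pool \<theta> - risk_DI \<theta>)"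
    by simp
qed

end
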